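(* Let $\mathcal{T}$ be a Horn-$\mathcal{SRIQ}$ TBox and let $\mathcal{T}^\exists$ be the set of existential axioms (axioms of the form $A\sqsubseteq\exists R.B$) in $\mathcal{T}$. If $\mathcal{T}$ is $\mathrm{MFA}^\cup$, then $\mathcal{T}$ is $\mathrm{RCA}_n$ for every $n>|\mathcal{T}^\exists|$.
   Context: Terms are built from constants (individuals) and function symbols. A term $t'$ is a subterm of $t$ if $t'=t$, or $t=f(s_1,\dots,s_k)$ and $t'$ is a subterm of some $s_i$; it is a proper subterm if moreover $t'\ne t$. A term $t$ is $n$-cyclic iff there are terms $f(\vec s_1),\dots,f(\vec s_{n+1})$ (same function symbol $f$) such that $f(\vec s_{n+1})$ is a subterm of $t$ and $f(\vec s_i)$ is a proper subterm of $f(\vec s_{i+1})$ for $i=1,\dots,n$; $1$-cyclic terms are called cyclic. A fact is a ground atom. A Horn-$\mathcal{SRIQ}$ TBox is a finite set of axioms of the forms $A_1\sqcap\dots\sqcap A_n\sqsubseteq B$, $A\sqsubseteq\forall R.B$, $A\sqsubseteq\,\leq 1 R.B$, $A\sqsubseteq\exists R.B$ (existential axioms), $S\sqsubseteq R$, $S^-\sqsubseteq R$, $S\circ V\sqsubseteq R$, where $A_i,A,B$ are concept names ($\top,\bot$ among them) and $R,S,V$ role names, satisfying the usual Horn-$\mathcal{SRIQ}$ global restrictions. Each axiom is translated into a rule: $A_1\sqcap\dots\sqcap A_n\sqsubseteq B\mapsto A_1(x)\wedge\dots\wedge A_n(x)\to B(x)$; $A\sqsubseteq\forall R.B\mapsto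 A(x)\wedge R(x,y)\to B(y)$; $A\sqsubseteq\,\leq1R.B\mapsto A(x)\wedge R(x,y)\wedge B(y)\wedge R(x,z)\wedge B(z)\to y\approx z$; $A\sqsubseteq\exists R.B\mapsto A(x)\to\exists y[R(x,y)\wedge B(y)]$; $S\sqsubseteq R\mapsto S(x,y)\to R(x,y)$; $S^-\sqsubseteq R\mapsto S(y,x)\to R(x,y)$; $S\circ V\sqsubseteq R\mapsto S(x,y)\wedge V(y,z)\to R(x,z)$. $\mathcal{R}_\mathcal{T}$ is the set of translations of the axioms of $\mathcal{T}$ together with, for every predicate $p$ of arity $k$ occurring, the rule $p(x_1,\dots,x_k)\to\top(x_1)\wedge\dots\wedge\top(x_k)$. Rules of the form $\beta(\vec x,\vec z)\to\exists\vec y\,\eta(\vec x,\vec y)$ are TGDs, rules $\beta(\vec x)\to x\approx y$ are EGDs. For a rule set $\mathcal{R}$: $\mathcal{R}^\exists$ = TGDs with existentially quantified variables, $\mathcal{R}^\forall$ = TGDs without, $\mathcal{R}^\approx$ = EGDs. A program is a pair $\langle\mathcal{R},\mathcal{I}\rangle$ with $\mathcal{I}$ a finite set of equality-free facts. Skolemization: for a TGD $\rho=\beta(\vec x,\vec z)\to\exists\vec y\,\eta(\vec x,\vec y)$, $sk(\rho)$ is $\beta\to\eta\sigma_{sk}$ where $\sigma_{sk}$ maps each $y\in\vec y$ to $f^y_\rho(\vec x)$ with $f^y_\rho$ a fresh function symbol unique to $y$ and $\rho$. Restricted application: for a TGD $\rho$ and a set of facts $F$, $\rho_R(F)$ is the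 set of facts $\varphi$ such that there is a substitution $\sigma$ with $\beta\sigma\subseteq F$, $\varphi\in sk(\eta)\sigma$, and there is no substitution $\tau\supseteq\sigma$ with $\eta\tau\subseteq F$; for a set of TGDs, $\mathcal{R}_R(F)=F\cup\bigcup_{\rho\in\mathcal{R}}\rho_R(F)$. The depth of a term is $0$ for constants and $1+\max_i dep(t_i)$ for $f(t_1,\dots,t_k)$. Fix a total strict order $\prec$ on terms with $t\prec u$ only if $dep(t)\le dep(u)$ ("$t$ is greater than $u$"). For a set of EGDs $\mathcal{R}$ and facts $F$, let $\mapsto$ be the minimal congruence relation on terms containing $(\sigma(x),\sigma(y))$ for every EGD $\beta(\vec x)\to x\approx y\in\mathcal{R}$ and substitution $\sigma$ with $\beta\sigma\subseteq F$; $\mathcal{R}(F)$ is obtained from $F$ by replacing every term $t$ by the $\prec$-greatest $u$ with $t\mapsto u$. The restricted chase sequence of $\langle\mathcal{R},\mathcal{I}\rangle$: $F_1=\mathcal{I}$, and for $i\ge2$, $F_i=\mathcal{R}^\approx(F_{i-1})$ if this differs from $F_{i-1}$; otherwise $F_i=(\mathcal{R}^\forall)_R(F_{i-1})$ if this differs from $F_{i-1}$; otherwise $F_i=(\mathcal{R}^\exists)_R(F_{i-1})$. The restricted chase is $\mathrm{rChase}=\bigcup_i F_i$. Restricted terms: for a term $t$: if $t=f^y_\rho(s)$ where $\rho=A(x)\to\exists y[R(x,y)\wedge B(y)]\in\mathcal{R}_\mathcal{T}$, let $\mathcal{I}(t)=\{A(s),R(s,t),B(t)\}\cup\mathcal{I}(s)$;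 otherwise $\mathcal{I}(t)=\emptyset$. Let $RT(\mathcal{T},t)=\langle\mathcal{R}_\mathcal{T}^\forall\cup\mathcal{R}_\mathcal{T}^\approx,\mathcal{I}(t)\rangle$. A term $t=f^y_\rho(s)$ with $\rho=A(x)\to\exists y[R(x,y)\wedge B(y)]$ is restricted with respect to $\mathcal{T}$ iff there is a term $u$ with $\{R([s],u),B(u)\}\subseteq\mathrm{rChase}(RT(\mathcal{T},s))$, where $[s]=v$ if $s$ is replaced by $v$ during the computation of the restricted chase sequence, and $[s]=s$ otherwise. The set $\mathcal{V}_\mathcal{T}$: let $\star$ be a special constant, $Eq$ a fresh binary predicate, and let the critical instance $\mathcal{I}^\star$ be the set of all facts $p(\star,\dots,\star)$ for predicates $p$ occurring in TGDs of $\mathcal{R}_\mathcal{T}$. $\mathcal{V}_\mathcal{T}$ is the set obtained from $\mathcal{I}^\star$ by repeatedly applying the following expansion rules (in any order) until none applies: ($\forall$-rule) for a TGD $\rho\in\mathcal{R}_\mathcal{T}^\forall$, add $\rho_R(\mathcal{V}_\mathcal{T})$; ($\exists$-rule) for $\rho=A(x)\to\exists y[R(x,y)\wedge B(y)]\in\mathcal{R}_\mathcal{T}$ and a term $t$ with $A(t)\in\mathcal{V}_\mathcal{T}$ such that $f^y_\rho(t)$ is not restricted with respect to $\mathcal{T}$, add $R(t,f^y_\rho(t))$ and $B(f^y_\rho(t))$; ($\approx$-rule) for an EGD $\beta\to x\approx y\in\mathcal{R}_\mathcal{T}$ and substitution $\sigma$ with $\beta\sigma\subseteq\mathcal{V}_\mathcal{T}$,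 add $Eq(\sigma(x),\sigma(y))$ and $Eq(\sigma(y),\sigma(x))$; ($Eq$-rule) if $Eq(t,u)\in\mathcal{V}_\mathcal{T}$ and $p(u_1,\dots,u_k)\in\mathcal{V}_\mathcal{T}$ with $p\ne Eq$, $dep(t)\le dep(u)$ and $u=u_j$ for some $j$, add the fact obtained from $p(u_1,\dots,u_k)$ by replacing $u$ with $t$. A TBox $\mathcal{T}$ is $\mathrm{RCA}_n$ iff no $n$-cyclic term occurs in $\mathcal{V}_\mathcal{T}$. $\mathrm{MFA}^\cup$: Let $\Sigma_\mathcal{T}$ be the set of TGDs obtained from $\mathcal{R}_\mathcal{T}$ by replacing every EGD $\beta\to x\approx y$ by the TGD $\beta\to Eq(x,y)$. Let $\mathsf{Eq}=\{\top(x)\to Eq(x,x),\ Eq(x,y)\to Eq(y,x),\ Eq(x,z)\wedge Eq(z,y)\to Eq(x,y)\}$. A singularization of a rule $\rho$ is obtained by doing, for every variable $v$ in the body: rename its occurrences in the body by distinct fresh variables $v_1,\dots,v_m$, pick some $j\in\{1,\dots,m\}$, add $Eq(v_1,v_j),\dots,Eq(v_m,v_j)$ to the body, and replace every occurrence of $v$ in the head by $v_j$. $\mathrm{Sing}(\Sigma)$ is the set of all sets $\Sigma'$ consisting of $\mathsf{Eq}$ plus exactly one singularization of each rule of $\Sigma$. A set of TGDs $\Sigma$ is MFA iff the least set of facts containing the critical instance of $\Sigma$ (all facts $p(\star,\dots,\star)$ for predicates $p$ in $\Sigma$) and closed under the skolemized rules $sk(\rho)$, $\rho\in\Sigma$ (the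 oblivious chase) contains no cyclic term. $\mathcal{T}$ is $\mathrm{MFA}^\cup$ iff $\bigcup_{\Sigma'\in\mathrm{Sing}(\Sigma_\mathcal{T})}\Sigma'$ is MFA.
   Formalization: In a singularization the trivial atom Eq(v_j,v_j) for the picked occurrence is not added to the body; with it, A⊑∃R.A would be MFA^∪ (⊤ and reflexive Eq guard each other) yet not RCA_n for any n, so the claim would fail. *)

theory Defs
  imports Main
begin

section \<open>Terms\<close>

datatype ('f, 'c) trm = Const 'c | Fun 'f "('f, 'c) trm list"

inductive subterm :: "('f, 'c) trm \<Rightarrow> ('f, 'c) trm \<Rightarrow> bool" where
  subterm_refl: "subterm t t"
| subterm_arg: "s \<in> set ss \<Longrightarrow> subterm t s \<Longrightarrow> subterm t (Fun f ss)"

definition proper_subterm :: "('f, 'c) trm \<Rightarrow> ('f, 'c) trm \<Rightarrow> bool" where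
  "proper_subterm t u \<longleftrightarrow> subterm t u \<and> t \<noteq> u"

definition n_cyclic :: "nat \<Rightarrow> ('f, 'c) trm \<Rightarrow> bool" where
  "n_cyclic n t \<longleftrightarrow> (\<exists>f (s :: nat \<Rightarrow> ('f, 'c) trm list).
     subterm (Fun f (s (n + 1))) t \<and>
     (\<forall>i \<in> {1..n}. proper_subterm (Fun f (s i)) (Fun f (s (i + 1)))))"

abbreviation cyclic :: "('f, 'c) trm \<Rightarrow> bool" where
  "cyclic \<equiv> n_cyclic 1"

fun dep :: "('f, 'c) trm \<Rightarrow> nat" where
  "dep (Const c) = 0"
| "dep (Fun f ts) = 1 + Max (set (0 # map dep ts))"

text \<open>The relation \<open>prec t u\<close> is read ``\<open>t\<close> is greater than \<open>u\<close>''; so the greatest term of a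
  set is its \<open>prec\<close>-minimum, a term of least depth.\<close>

definition term_order :: "(('f, 'c) trm \<Rightarrow> ('f, 'c) trm \<Rightarrow> bool) \<Rightarrow> bool" where
  "term_order prec \<longleftrightarrow> irreflp prec \<and> transp prec \<and> totalp prec \<and>
     (\<forall>t u. prec t u \<longrightarrow> dep t \<le> dep u)"

inductive congr :: "(('f, 'c) trm \<times> ('f, 'c) trm) set \<Rightarrow> ('f, 'c) trm \<Rightarrow> ('f, 'c) trm \<Rightarrow> bool"
  for E where
  congr_base: "(t, u) \<in> E \<Longrightarrow> congr E t u"
| congr_refl: "congr E t t"
| congr_sym: "congr E t u \<Longrightarrow> congr E u t"
| congr_trans: "congr E t u \<Longrightarrow> congr E u v \<Longrightarrow> congr E t v"
| congr_fun: "list_all2 (congr E) ts us \<Longrightarrow> congr E (Fun f ts) (Fun f us)"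

section \<open>Atoms, rules and their application\<close>

datatype ('p, 't) atom = Atom (pred_of: 'p) (args: "'t list")

abbreviation inst :: "('s \<Rightarrow> 't) \<Rightarrow> ('p, 's) atom \<Rightarrow> ('p, 't) atom" where
  "inst \<sigma> \<equiv> map_atom id \<sigma>"

definition occurrences :: "('p, 'v) atom list \<Rightarrow> 'v list" where
  "occurrences as = concat (map args as)"

definition avars :: "('p, 'v) atom list \<Rightarrow> 'v set" where
  "avars as = set (occurrences as)"

definition terms_in :: "('p, 't) atom set \<Rightarrow> 't set" where
  "terms_in F = (\<Union>\<phi>\<in>F. set (args \<phi>))"

text \<open>The existentially quantified variables of a TGD are the head variables that do not occur
  in the body.\<close>

datatype ('p, 'v) rule =
  TGD "('p, 'v) atom list" "('p, 'v) atom list"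
| EGD "('p, 'v) atom list" 'v 'v

text \<open>The Skolem symbol of the existential variable \<open>y\<close> of the rule \<open>\<rho>\<close> is the pair
  \<open>(\<rho>, y)\<close>, which is unique to \<open>\<rho>\<close> and \<open>y\<close>.\<close>

type_synonym ('p, 'v, 'c) sk_trm = "(('p, 'v) rule \<times> 'v, 'c) trm"
type_synonym ('p, 'v, 'c) fact = "('p, ('p, 'v, 'c) sk_trm) atom"

definition ex_rules :: "('p, 'v) rule set \<Rightarrow> ('p, 'v) rule set" where
  "ex_rules R = {TGD b h | b h. TGD b h \<in> R \<and> \<not> avars h \<subseteq> avars b}"

definition all_rules :: "('p, 'v) rule set \<Rightarrow> ('p, 'v) rule set" where
  "all_rules R = {TGD b h | b h. TGD b h \<in> R \<and> avars h \<subseteq> avars b}"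

definition eq_rules :: "('p, 'v) rule set \<Rightarrow> ('p, 'v) rule set" where
  "eq_rules R = {EGD b x y | b x y. EGD b x y \<in> R}"

definition frontier_vars :: "('p, 'v) atom list \<Rightarrow> ('p, 'v) atom list \<Rightarrow> 'v list" where
  "frontier_vars b h = filter (\<lambda>v. v \<in> avars h) (remdups (occurrences b))"

text \<open>For the TGD with body \<open>b\<close> and head \<open>h\<close>, this is the composition of the Skolem substitution
  with \<open>\<sigma>\<close>.\<close>

definition sk_subst :: "('p, 'v) atom list \<Rightarrow> ('p, 'v) atom list \<Rightarrow>
    ('v \<Rightarrow> ('p, 'v, 'c) sk_trm) \<Rightarrow> 'v \<Rightarrow> ('p, 'v, 'c) sk_trm" where
  "sk_subst b h \<sigma> v =
     (if v \<in> avars b then \<sigma> v else Fun (TGD b h, v) (map \<sigma> (frontier_vars b h)))"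

text \<open>Substitutions are total functions on variables; only their values on the body variables
  (for \<open>\<sigma>\<close>) matter, so \<open>\<tau> \<supseteq> \<sigma>\<close> is agreement on the body variables.\<close>

definition tgd_apply :: "('p, 'v) rule \<Rightarrow> ('p, 'v, 'c) fact set \<Rightarrow> ('p, 'v, 'c) fact set" where
  "tgd_apply \<rho> F = {\<phi>. \<exists>b h \<sigma>. \<rho> = TGD b h \<and> inst \<sigma> ` set b \<subseteq> F \<and>
     \<phi> \<in> inst (sk_subst b h \<sigma>) ` set h \<and>
     \<not> (\<exists>\<tau>. (\<forall>v \<in> avars b. \<tau> v = \<sigma> v) \<and> inst \<tau> ` set h \<subseteq> F)}"

definition tgds_apply ::
    "('p, 'v) rule set \<Rightarrow> ('p, 'v, 'c) fact set \<Rightarrow> ('p, 'v, 'c) fact set" where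
  "tgds_apply R F = F \<union> (\<Union>\<rho>\<in>R. tgd_apply \<rho> F)"

definition egd_pairs :: "('p, 'v) rule set \<Rightarrow> ('p, 'v, 'c) fact set \<Rightarrow>
    (('p, 'v, 'c) sk_trm \<times> ('p, 'v, 'c) sk_trm) set" where
  "egd_pairs R F = {(\<sigma> x, \<sigma> y) | b x y \<sigma>. EGD b x y \<in> R \<and> inst \<sigma> ` set b \<subseteq> F}"

definition egd_repl ::
    "(('p, 'v, 'c) sk_trm \<Rightarrow> ('p, 'v, 'c) sk_trm \<Rightarrow> bool) \<Rightarrow> ('p, 'v) rule set \<Rightarrow>
     ('p, 'v, 'c) fact set \<Rightarrow> ('p, 'v, 'c) sk_trm \<Rightarrow> ('p, 'v, 'c) sk_trm" where
  "egd_repl prec R F t = (THE u. congr (egd_pairs R F) t u \<and>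
     (\<forall>w. congr (egd_pairs R F) t w \<and> w \<noteq> u \<longrightarrow> prec u w))"

definition egds_apply ::
    "(('p, 'v, 'c) sk_trm \<Rightarrow> ('p, 'v, 'c) sk_trm \<Rightarrow> bool) \<Rightarrow> ('p, 'v) rule set \<Rightarrow>
     ('p, 'v, 'c) fact set \<Rightarrow> ('p, 'v, 'c) fact set" where
  "egds_apply prec R F = inst (egd_repl prec R F) ` F"

section \<open>The restricted chase\<close>

primrec chase_seq ::
    "(('p, 'v, 'c) sk_trm \<Rightarrow> ('p, 'v, 'c) sk_trm \<Rightarrow> bool) \<Rightarrow> ('p, 'v) rule set \<Rightarrow>
     ('p, 'v, 'c) fact set \<Rightarrow> nat \<Rightarrow> ('p, 'v, 'c) fact set" where
  "chase_seq prec R I 0 = I"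
| "chase_seq prec R I (Suc i) = (let F = chase_seq prec R I i in
     if egds_apply prec (eq_rules R) F \<noteq> F then egds_apply prec (eq_rules R) F
     else if tgds_apply (all_rules R) F \<noteq> F then tgds_apply (all_rules R) F
     else tgds_apply (ex_rules R) F)"

definition rChase ::
    "(('p, 'v, 'c) sk_trm \<Rightarrow> ('p, 'v, 'c) sk_trm \<Rightarrow> bool) \<Rightarrow> ('p, 'v) rule set \<Rightarrow>
     ('p, 'v, 'c) fact set \<Rightarrow> ('p, 'v, 'c) fact set" where
  "rChase prec R I = (\<Union>i. chase_seq prec R I i)"

text \<open>\<open>repl_seq prec R I s i\<close> is the term that has taken the place of \<open>s\<close> after \<open>i\<close> steps of the
  chase sequence. A term may be replaced several times in a row; \<open>repl_final\<close> is the value at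
  which this stabilises.\<close>

primrec repl_seq ::
    "(('p, 'v, 'c) sk_trm \<Rightarrow> ('p, 'v, 'c) sk_trm \<Rightarrow> bool) \<Rightarrow> ('p, 'v) rule set \<Rightarrow>
     ('p, 'v, 'c) fact set \<Rightarrow> ('p, 'v, 'c) sk_trm \<Rightarrow> nat \<Rightarrow> ('p, 'v, 'c) sk_trm" where
  "repl_seq prec R I s 0 = s"
| "repl_seq prec R I s (Suc i) = (let F = chase_seq prec R I i in
     if egds_apply prec (eq_rules R) F \<noteq> F
     then egd_repl prec (eq_rules R) F (repl_seq prec R I s i)
     else repl_seq prec R I s i)"

definition repl_final ::
    "(('p, 'v, 'c) sk_trm \<Rightarrow> ('p, 'v, 'c) sk_trm \<Rightarrow> bool) \<Rightarrow> ('p, 'v) rule set \<Rightarrow>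
     ('p, 'v, 'c) fact set \<Rightarrow> ('p, 'v, 'c) sk_trm \<Rightarrow> ('p, 'v, 'c) sk_trm" where
  "repl_final prec R I s = (THE v. \<exists>N. \<forall>i\<ge>N. repl_seq prec R I s i = v)"

section \<open>Horn-SRIQ TBoxes\<close>

datatype 'a concept = Top | Bot | CName 'a

text \<open>In this order: $A_1 \sqcap \dots \sqcap A_n \sqsubseteq B$;
  $A \sqsubseteq \forall R.B$; $A \sqsubseteq\; \leq 1\, R.B$; $A \sqsubseteq \exists R.B$;
  $S \sqsubseteq R$; $S^- \sqsubseteq R$; $S \circ V \sqsubseteq R$.\<close>

datatype ('a, 'r) dl_axiom =
  ConjSub "'a concept list" "'a concept"
| SubAll "'a concept" 'r "'a concept"
| SubAtMostOne "'a concept" 'r "'a concept"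
| SubEx "'a concept" 'r "'a concept"
| RoleSub 'r 'r
| RoleInvSub 'r 'r
| RoleComp 'r 'r 'r

type_synonym ('a, 'r) tbox = "('a, 'r) dl_axiom set"

inductive non_simple :: "('a, 'r) tbox \<Rightarrow> 'r \<Rightarrow> bool" for T where
  "RoleComp S V R \<in> T \<Longrightarrow> non_simple T R"
| "RoleSub S R \<in> T \<Longrightarrow> non_simple T S \<Longrightarrow> non_simple T R"
| "RoleInvSub S R \<in> T \<Longrightarrow> non_simple T S \<Longrightarrow> non_simple T R"

definition role_hierarchy :: "('a, 'r) tbox \<Rightarrow> ('r \<times> 'r) set" where
  "role_hierarchy T = {(S, R). RoleSub S R \<in> T \<or> RoleInvSub S R \<in> T}\<^sup>*"

text \<open>Regularity of the role axioms in the form used for OWL 2 DL, which admits mutually inverse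
  and equivalent role names and subsumes the stricter variant in which \<open>S \<sqsubseteq> R\<close> requires
  \<open>S < R\<close>. The order identifies a role with its inverse, so it is given on role names.\<close>

definition regular :: "('a, 'r) tbox \<Rightarrow> bool" where
  "regular T \<longleftrightarrow> (\<exists>less :: ('r \<times> 'r) set. irrefl less \<and> trans less \<and>
     (\<forall>(S, R) \<in> role_hierarchy T. (R, S) \<notin> less) \<and>
     (\<forall>S V R. RoleComp S V R \<in> T \<longrightarrow>
        S = R \<and> V = R \<or>
        (S, R) \<in> less \<and> (V, R) \<in> less \<or>
        S = R \<and> (V, R) \<in> less \<or>
        (S, R) \<in> less \<and> V = R))"

definition horn_sriq_tbox :: "('a, 'r) tbox \<Rightarrow> bool" where
  "horn_sriq_tbox T \<longleftrightarrow> finite T \<and>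
     (\<forall>As B. ConjSub As B \<in> T \<longrightarrow> As \<noteq> []) \<and>
     (\<forall>A R B. SubAtMostOne A R B \<in> T \<longrightarrow> \<not> non_simple T R) \<and>
     regular T"

definition existential_axioms :: "('a, 'r) tbox \<Rightarrow> ('a, 'r) tbox" where
  "existential_axioms T = {SubEx A R B | A R B. SubEx A R B \<in> T}"

section \<open>Translation into rules\<close>

datatype ('a, 'r) pred = Conc "'a concept" | Role 'r | Eq

fun arity :: "('a, 'r) pred \<Rightarrow> nat" where
  "arity (Conc A) = 1"
| "arity (Role R) = 2"
| "arity Eq = 2"

text \<open>\<open>Occ v i\<close> is the fresh variable that renames the \<open>i\<close>-th occurrence of \<open>v\<close> in a
  singularization.\<close>

datatype var = X | Y | Z | Occ var nat

type_synonym ('a, 'r) dl_rule = "(('a, 'r) pred, var) rule"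

text \<open>Terms are built over arbitrary individuals and the special constant \<open>Star\<close>.\<close>

datatype 'i const = Star | Ind 'i

type_synonym ('a, 'r, 'i) dl_trm = "(('a, 'r) pred, var, 'i const) sk_trm"
type_synonym ('a, 'r, 'i) dl_fact = "(('a, 'r) pred, var, 'i const) fact"

definition ex_rule :: "'a concept \<Rightarrow> 'r \<Rightarrow> 'a concept \<Rightarrow> ('a, 'r) dl_rule" where
  "ex_rule A R B = TGD [Atom (Conc A) [X]] [Atom (Role R) [X, Y], Atom (Conc B) [Y]]"

fun rule_of :: "('a, 'r) dl_axiom \<Rightarrow> ('a, 'r) dl_rule" where
  "rule_of (ConjSub As B) = TGD (map (\<lambda>A. Atom (Conc A) [X]) As) [Atom (Conc B) [X]]"
| "rule_of (SubAll A R B) =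
     TGD [Atom (Conc A) [X], Atom (Role R) [X, Y]] [Atom (Conc B) [Y]]"
| "rule_of (SubAtMostOne A R B) =
     EGD [Atom (Conc A) [X], Atom (Role R) [X, Y], Atom (Conc B) [Y],
          Atom (Role R) [X, Z], Atom (Conc B) [Z]] Y Z"
| "rule_of (SubEx A R B) = ex_rule A R B"
| "rule_of (RoleSub S R) = TGD [Atom (Role S) [X, Y]] [Atom (Role R) [X, Y]]"
| "rule_of (RoleInvSub S R) = TGD [Atom (Role S) [Y, X]] [Atom (Role R) [X, Y]]"
| "rule_of (RoleComp S V R) =
     TGD [Atom (Role S) [X, Y], Atom (Role V) [Y, Z]] [Atom (Role R) [X, Z]]"

fun rule_preds :: "('p, 'v) rule \<Rightarrow> 'p set" where
  "rule_preds (TGD b h) = pred_of ` (set b \<union> set h)"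
| "rule_preds (EGD b x y) = pred_of ` set b"

definition top_rule :: "('a, 'r) pred \<Rightarrow> ('a, 'r) dl_rule" where
  "top_rule p = (let xs = take (arity p) [X, Y] in
     TGD [Atom p xs] (map (\<lambda>x. Atom (Conc Top) [x]) xs))"

definition rules_of :: "('a, 'r) tbox \<Rightarrow> ('a, 'r) dl_rule set" where
  "rules_of T = rule_of ` T \<union> top_rule ` (\<Union>\<alpha>\<in>T. rule_preds (rule_of \<alpha>))"

definition critical_instance :: "('a, 'r) dl_rule set \<Rightarrow> ('a, 'r, 'i) dl_fact set" where
  "critical_instance R = {Atom p (replicate (arity p) (Const Star)) | p.
     \<exists>b h. TGD b h \<in> R \<and> p \<in> rule_preds (TGD b h)}"

section \<open>Restricted terms and \<open>RCA\<^sub>n\<close>\<close>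

abbreviation sk_ex ::
    "'a concept \<Rightarrow> 'r \<Rightarrow> 'a concept \<Rightarrow> ('a, 'r, 'i) dl_trm \<Rightarrow> ('a, 'r, 'i) dl_trm" where
  "sk_ex A R B s \<equiv> Fun (ex_rule A R B, Y) [s]"

fun inst_of :: "('a, 'r) tbox \<Rightarrow> ('a, 'r, 'i) dl_trm \<Rightarrow> ('a, 'r, 'i) dl_fact set" where
  "inst_of T (Fun (\<rho>, y) [s]) = {\<phi>. \<exists>A R B. \<rho> = ex_rule A R B \<and> y = Y \<and> \<rho> \<in> rules_of T \<and>
     \<phi> \<in> {Atom (Conc A) [s], Atom (Role R) [s, sk_ex A R B s], Atom (Conc B) [sk_ex A R B s]}
         \<union> inst_of T s}"
| "inst_of T _ = {}"

definition rt_rules :: "('a, 'r) tbox \<Rightarrow> ('a, 'r) dl_rule set" where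
  "rt_rules T = all_rules (rules_of T) \<union> eq_rules (rules_of T)"

definition restricted :: "(('a, 'r, 'i) dl_trm \<Rightarrow> ('a, 'r, 'i) dl_trm \<Rightarrow> bool) \<Rightarrow>
    ('a, 'r) tbox \<Rightarrow> ('a, 'r, 'i) dl_trm \<Rightarrow> bool" where
  "restricted prec T t \<longleftrightarrow> (\<exists>A R B s u. t = sk_ex A R B s \<and> ex_rule A R B \<in> rules_of T \<and>
     {Atom (Role R) [repl_final prec (rt_rules T) (inst_of T s) s, u], Atom (Conc B) [u]}
       \<subseteq> rChase prec (rt_rules T) (inst_of T s))"

definition V_closed :: "(('a, 'r, 'i) dl_trm \<Rightarrow> ('a, 'r, 'i) dl_trm \<Rightarrow> bool) \<Rightarrow>
    ('a, 'r) tbox \<Rightarrow> ('a, 'r, 'i) dl_fact set \<Rightarrow> bool" where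
  "V_closed prec T V \<longleftrightarrow>
     (\<forall>\<rho> \<in> all_rules (rules_of T). tgd_apply \<rho> V \<subseteq> V) \<and>
     (\<forall>A R B t. ex_rule A R B \<in> rules_of T \<and> Atom (Conc A) [t] \<in> V \<and>
        \<not> restricted prec T (sk_ex A R B t) \<longrightarrow>
        {Atom (Role R) [t, sk_ex A R B t], Atom (Conc B) [sk_ex A R B t]} \<subseteq> V) \<and>
     (\<forall>b x y \<sigma>. EGD b x y \<in> rules_of T \<and> inst \<sigma> ` set b \<subseteq> V \<longrightarrow>
        {Atom Eq [\<sigma> x, \<sigma> y], Atom Eq [\<sigma> y, \<sigma> x]} \<subseteq> V) \<and>
     (\<forall>t u p us. Atom Eq [t, u] \<in> V \<and> Atom p us \<in> V \<and> p \<noteq> Eq \<and> dep t \<le> dep u \<and>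
        u \<in> set us \<longrightarrow> Atom p (map (\<lambda>w. if w = u then t else w) us) \<in> V)"

text \<open>Saturation of the critical instance under the expansion rules. A rule without existential
  variables satisfies \<open>tgd_apply \<rho> V \<subseteq> V\<close> iff \<open>V\<close> is closed under it, so the intersection is
  itself closed and is the result of exhaustive rule application in any order.\<close>

definition V_set :: "(('a, 'r, 'i) dl_trm \<Rightarrow> ('a, 'r, 'i) dl_trm \<Rightarrow> bool) \<Rightarrow>
    ('a, 'r) tbox \<Rightarrow> ('a, 'r, 'i) dl_fact set" where
  "V_set prec T = \<Inter> {V. critical_instance (rules_of T) \<subseteq> V \<and> V_closed prec T V}"

definition RCA :: "(('a, 'r, 'i) dl_trm \<Rightarrow> ('a, 'r, 'i) dl_trm \<Rightarrow> bool) \<Rightarrow>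
    nat \<Rightarrow> ('a, 'r) tbox \<Rightarrow> bool" where
  "RCA prec n T \<longleftrightarrow> \<not> (\<exists>t \<in> terms_in (V_set prec T). n_cyclic n t)"

section \<open>MFA and \<open>MFA\<^sup>\<union>\<close>\<close>

inductive_set ochase :: "('a, 'r) dl_rule set \<Rightarrow> ('a, 'r, 'i) dl_fact set" for \<Sigma> where
  ochase_crit: "\<phi> \<in> critical_instance \<Sigma> \<Longrightarrow> \<phi> \<in> ochase \<Sigma>"
| ochase_step: "TGD b h \<in> \<Sigma> \<Longrightarrow> \<forall>\<phi> \<in> set b. inst \<sigma> \<phi> \<in> ochase \<Sigma> \<Longrightarrow> \<psi> \<in> set h \<Longrightarrow>
    inst (sk_subst b h \<sigma>) \<psi> \<in> ochase \<Sigma>"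

definition MFA :: "'i itself \<Rightarrow> ('a, 'r) dl_rule set \<Rightarrow> bool" where
  "MFA _ \<Sigma> \<longleftrightarrow> \<not> (\<exists>t \<in> terms_in (ochase \<Sigma> :: ('a, 'r, 'i) dl_fact set). cyclic t)"

fun eq_to_tgd :: "('a, 'r) dl_rule \<Rightarrow> ('a, 'r) dl_rule" where
  "eq_to_tgd (TGD b h) = TGD b h"
| "eq_to_tgd (EGD b x y) = TGD b [Atom Eq [x, y]]"

definition Sigma_of :: "('a, 'r) tbox \<Rightarrow> ('a, 'r) dl_rule set" where
  "Sigma_of T = eq_to_tgd ` rules_of T"

definition Eq_axioms :: "('a, 'r) dl_rule set" where
  "Eq_axioms =
     {TGD [Atom (Conc Top) [X]] [Atom Eq [X, X]],
      TGD [Atom Eq [X, Y]] [Atom Eq [Y, X]],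
      TGD [Atom Eq [X, Z], Atom Eq [Z, Y]] [Atom Eq [X, Y]]}"

text \<open>The first argument collects the variable occurrences already passed.\<close>

fun rename_vars :: "var list \<Rightarrow> var list \<Rightarrow> var list" where
  "rename_vars seen [] = []"
| "rename_vars seen (v # vs) = Occ v (count_list seen v + 1) # rename_vars (seen @ [v]) vs"

fun rename_body :: "var list \<Rightarrow> ('p, var) atom list \<Rightarrow> ('p, var) atom list" where
  "rename_body seen [] = []"
| "rename_body seen (Atom p vs # as) = Atom p (rename_vars seen vs) # rename_body (seen @ vs) as"

text \<open>The choice function \<open>j\<close> picks the occurrence that represents each body variable. Only the
  occurrences other than the picked one are equated with it: with a reflexive atom
  \<open>Eq(v\<^sub>j, v\<^sub>j)\<close> in every body, the rules deriving \<open>Top\<close> would be guarded by reflexivity of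
  \<open>Eq\<close>, which is itself only derivable from \<open>Top\<close>, and no rule would ever apply to a
  Skolem term.\<close>

definition eq_atoms :: "(var \<Rightarrow> nat) \<Rightarrow> var list \<Rightarrow> (('a, 'r) pred, var) atom list" where
  "eq_atoms j occ = concat (map (\<lambda>v.
     map (\<lambda>i. Atom Eq [Occ v i, Occ v (j v)])
         (filter (\<lambda>i. i \<noteq> j v) [1..<count_list occ v + 1]))
     (remdups occ))"

definition singularize ::
    "(var \<Rightarrow> nat) \<Rightarrow> (('a, 'r) pred, var) atom list \<Rightarrow> (('a, 'r) pred, var) atom list \<Rightarrow>
     ('a, 'r) dl_rule" where
  "singularize j b h = TGD (rename_body [] b @ eq_atoms j (occurrences b))
     (map (inst (\<lambda>v. if v \<in> avars b then Occ v (j v) else v)) h)"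

definition singularizations :: "('a, 'r) dl_rule \<Rightarrow> ('a, 'r) dl_rule set" where
  "singularizations \<rho> = {singularize j b h | j b h. \<rho> = TGD b h \<and>
     (\<forall>v \<in> avars b. 1 \<le> j v \<and> j v \<le> count_list (occurrences b) v)}"

definition Sing :: "('a, 'r) dl_rule set \<Rightarrow> ('a, 'r) dl_rule set set" where
  "Sing \<Sigma> = {Eq_axioms \<union> g ` \<Sigma> | g. \<forall>\<rho> \<in> \<Sigma>. g \<rho> \<in> singularizations \<rho>}"

definition MFA_union :: "'i itself \<Rightarrow> ('a, 'r) tbox \<Rightarrow> bool" where
  "MFA_union ind T \<longleftrightarrow> MFA ind (\<Union> (Sing (Sigma_of T)))"

end

theory Submission
  imports Defs
begin

text \<open>If the oblivious chase \<open>O\<close> of the singularized rules has no cyclic term, then no Skolem symbol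
  repeats along a branch, so its terms have depth at most the number of existential axioms. The
  set \<open>V\<close> is simulated in \<open>O\<close> up to \<open>Eq\<close>: every fact of \<open>V\<close> has a shadow in \<open>O\<close> whose arguments are
  \<open>Eq\<close>-equivalent and at least as deep. Replacing a term of \<open>V\<close> by an equal one never increases its
  depth, so the shadow can be kept unchanged. Hence \<open>V\<close> obeys the same depth bound, while an
  \<open>n\<close>-cyclic term has depth greater than \<open>n\<close>.\<close>

section \<open>Depth and cyclicity\<close>

lemma dep_arg_less: "s \<in> set ss \<Longrightarrow> dep s < dep (Fun f ss)"
  by (auto simp: less_Suc_eq_le intro!: Max_ge)

lemma subterm_dep_le: "subterm t u \<Longrightarrow> dep t \<le> dep u"
proof (induction rule: subterm.induct)
  case (subterm_arg s ss t f)
  then show ?case using dep_arg_less[of s ss f] by linarith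
qed simp

lemma proper_subterm_dep_less:
  assumes "proper_subterm t u"
  shows "dep t < dep u"
proof -
  from assms have "subterm t u" "t \<noteq> u" by (auto simp: proper_subterm_def)
  then show ?thesis
  proof (cases rule: subterm.cases)
    case (subterm_arg s ss f)
    then show ?thesis using subterm_dep_le[of t s] dep_arg_less[of s ss f] by simp
  qed simp
qed

text \<open>Each link of the chain raises the depth, and the innermost term, being a function
  application, already has depth at least 1; this makes the bound strict.\<close>

lemma n_cyclic_imp_dep:
  assumes "n_cyclic n t"
  shows "n < dep t"
proof -
  from assms obtain f s where sub: "subterm (Fun f (s (n + 1))) t"
    and step: "\<And>i. i \<in> {1..n} \<Longrightarrow> proper_subterm (Fun f (s i)) (Fun f (s (i + 1)))"
    by (auto simp: n_cyclic_def)
  have "i \<le> n \<Longrightarrow> i < dep (Fun f (s (i + 1)))" for i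
  proof (induction i)
    case (Suc i)
    then show ?case using proper_subterm_dep_less[OF step[of "Suc i"]] by (simp del: dep.simps)
  qed simp
  then show ?thesis using subterm_dep_le[OF sub] by (meson le_refl less_le_trans)
qed

lemma symbol_subterm: "f \<in> set1_trm t \<Longrightarrow> \<exists>ss. subterm (Fun f ss) t"
proof (induction t)
  case (Fun g ts)
  then show ?case by (cases "f = g") (auto intro: subterm.intros, meson subterm_arg)
qed simp

lemma cyclicI:
  assumes "subterm (Fun f us) s" "s \<in> set ss"
  shows "cyclic (Fun f ss)"
proof -
  have "subterm (Fun f us) (Fun f ss)" using assms by (auto intro: subterm.intros)
  \<comment> \<open>Otherwise \<open>Fun f ss\<close> would be a subterm of its own argument
    \<open>s\<close>, against the depths.\<close>
  moreover have "us \<noteq> ss"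
    using subterm_dep_le[OF assms(1)] dep_arg_less[OF assms(2), of f] by auto
  ultimately show ?thesis
    unfolding n_cyclic_def proper_subterm_def
    by (intro exI[of _ f] exI[of _ "\<lambda>i. if i = 1 then us else ss"])
      (auto intro: subterm.intros)
qed

lemma cyclic_arg: "cyclic s \<Longrightarrow> s \<in> set ss \<Longrightarrow> cyclic (Fun f ss)"
  unfolding n_cyclic_def by (meson subterm_arg)

lemma finite_symbols: "finite (set1_trm t)"
  by (induction t) auto

text \<open>By acyclicity the root symbol does not recur inside an argument. Each step down thus
  strictly shrinks \<open>set1_trm\<close>, the set of function symbols, which bounds the depth by
  induction.\<close>

lemma acyclic_dep_le: "\<not> cyclic t \<Longrightarrow> dep t \<le> card (set1_trm t)"
proof (induction t)
  case (Fun f ss)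
  have "dep s < card (set1_trm (Fun f ss))" if "s \<in> set ss" for s
  proof -
    have "f \<notin> set1_trm s"
      using symbol_subterm[of f s] cyclicI[of f _ s ss] Fun.prems that by blast
    then have "set1_trm s \<subset> set1_trm (Fun f ss)" using that by auto
    then have "card (set1_trm s) < card (set1_trm (Fun f ss))"
      by (rule psubset_card_mono[OF finite_symbols])
    moreover have "dep s \<le> card (set1_trm s)"
      using Fun.IH[OF that] Fun.prems cyclic_arg[OF _ that, of f] by argo
    ultimately show ?thesis by simp
  qed
  \<comment> \<open>The maximum in \<open>dep\<close> also ranges over the default 0, so 0 must lie
    below the cardinality as well.\<close>
  moreover have "0 < card (set1_trm (Fun f ss))"
    using finite_symbols[of "Fun f ss"] by (auto simp: card_gt_0_iff simp del: finite_insert)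
  ultimately show ?case
    by (auto simp: Suc_le_eq Max_less_iff simp del: trm.set)
qed simp

section \<open>Singularized rules\<close>

lemma rename_vars_bounds:
  "Occ v i \<in> set (rename_vars seen vs) \<longleftrightarrow>
     count_list seen v < i \<and> i \<le> count_list (seen @ vs) v"
  by (induction seen vs rule: rename_vars.induct) auto

lemma rename_vars_Occ: "w \<in> set (rename_vars seen vs) \<Longrightarrow> \<exists>v i. w = Occ v i"
  by (induction seen vs rule: rename_vars.induct) auto

lemma rename_vars_append:
  "rename_vars seen (us @ vs) = rename_vars seen us @ rename_vars (seen @ us) vs"
  by (induction seen us rule: rename_vars.induct) auto

lemma occurrences_Nil [simp]: "occurrences [] = []"
  and occurrences_Cons [simp]: "occurrences (Atom p vs # as) = vs @ occurrences as"
  and occurrences_append: "occurrences (as @ bs) = occurrences as @ occurrences bs"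
  by (simp_all add: occurrences_def)

lemma occurrences_rename_body:
  "occurrences (rename_body seen b) = rename_vars seen (occurrences b)"
  by (induction seen b rule: rename_body.induct) (auto simp: rename_vars_append)

lemma count_list_pos: "v \<in> set vs \<Longrightarrow> 1 \<le> count_list vs v"
  using count_list_0_iff[of vs v] by linarith

lemma pred_of_rename_body: "pred_of ` set (rename_body seen b) = pred_of ` set b"
  by (induction seen b rule: rename_body.induct) auto

lemma avars_inst: "avars (map (inst f) as) = f ` avars as"
  by (auto simp: avars_def occurrences_def atom.map_sel)

text \<open>Needed to see that singularization makes no universal variable existential: an
  admissible index names an occurrence present in the renamed body.\<close>

lemma avars_singularize_head:
  assumes "\<forall>v \<in> avars b. 1 \<le> j v \<and> j v \<le> count_list (occurrences b) v"
    and "v \<in> avars b"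
  shows "Occ v (j v) \<in> avars (rename_body [] b @ eq_atoms j (occurrences b))"
  using assms
  by (auto simp: avars_def occurrences_append occurrences_rename_body rename_vars_bounds
      less_eq_Suc_le)

text \<open>As every occurrence has its own variable, different occurrences of \<open>v\<close> may
  be matched with different terms, each only \<open>Q\<close>-related to
  \<open>\<sigma> v\<close>.\<close>

lemma match_rename_vars:
  assumes "list_all2 Q (map \<sigma> vs) ts"
  shows "\<exists>\<theta>. map \<theta> (rename_vars seen vs) = ts \<and>
    (\<forall>v i. count_list seen v < i \<longrightarrow> i \<le> count_list (seen @ vs) v \<longrightarrow> Q (\<sigma> v) (\<theta> (Occ v i)))"
  using assms
proof (induction vs arbitrary: seen ts)
  case (Cons x vs)
  then obtain t us where ts: "ts = t # us" and Q: "Q (\<sigma> x) t" and "list_all2 Q (map \<sigma> vs) us"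
    by (auto simp: list_all2_Cons1)
  from Cons.IH[OF this(3), of "seen @ [x]"] obtain \<theta> where
    \<theta>: "map \<theta> (rename_vars (seen @ [x]) vs) = us"
    "\<And>v i. count_list (seen @ [x]) v < i \<Longrightarrow> i \<le> count_list ((seen @ [x]) @ vs) v \<Longrightarrow>
       Q (\<sigma> v) (\<theta> (Occ v i))"
    by blast
  let ?o = "Occ x (count_list seen x + 1)"
  have "?o \<notin> set (rename_vars (seen @ [x]) vs)" by (simp add: rename_vars_bounds)
  then have "map (\<theta>(?o := t)) (rename_vars seen (x # vs)) = ts"
    using \<theta>(1) ts by simp
  moreover have "Q (\<sigma> v) ((\<theta>(?o := t)) (Occ v i))"
    if "count_list seen v < i" "i \<le> count_list (seen @ x # vs) v" for v i
    using \<theta>(2)[of v i] Q that by (auto split: if_splits)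
  ultimately show ?case by blast
qed auto

lemma match_rename_body:
  assumes "\<And>p vs. Atom p vs \<in> set b \<Longrightarrow> \<exists>ts. Atom p ts \<in> F \<and> list_all2 Q (map \<sigma> vs) ts"
  shows "\<exists>\<theta>. inst \<theta> ` set (rename_body seen b) \<subseteq> F \<and>
    (\<forall>v i. count_list seen v < i \<longrightarrow> i \<le> count_list (seen @ occurrences b) v \<longrightarrow>
       Q (\<sigma> v) (\<theta> (Occ v i)))"
  using assms
proof (induction seen b rule: rename_body.induct)
  case (2 seen p vs as)
  from "2.IH" "2.prems" obtain \<theta>2 where
    \<theta>2: "inst \<theta>2 ` set (rename_body (seen @ vs) as) \<subseteq> F"
    "\<And>v i. count_list (seen @ vs) v < i \<Longrightarrow> i \<le> count_list ((seen @ vs) @ occurrences as) v \<Longrightarrow>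
       Q (\<sigma> v) (\<theta>2 (Occ v i))"
    by (metis list.set_intros(2))
  obtain ts where ts: "Atom p ts \<in> F" "list_all2 Q (map \<sigma> vs) ts" using "2.prems" by auto
  from match_rename_vars[OF ts(2), of seen] obtain \<theta>1 where
    \<theta>1: "map \<theta>1 (rename_vars seen vs) = ts"
    "\<And>v i. count_list seen v < i \<Longrightarrow> i \<le> count_list (seen @ vs) v \<Longrightarrow> Q (\<sigma> v) (\<theta>1 (Occ v i))"
    by blast
  \<comment> \<open>Variables of the first atom follow \<open>\<theta>1\<close>, all others
    \<open>\<theta>2\<close>; the index ranges do not overlap, so both matches survive the
    gluing.\<close>
  define \<theta> where "\<theta> w = (if w \<in> set (rename_vars seen vs) then \<theta>1 w else \<theta>2 w)" for w
  have "inst \<theta> \<phi> = inst \<theta>2 \<phi>" if "\<phi> \<in> set (rename_body (seen @ vs) as)" for \<phi>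
  proof -
    have "w \<notin> set (rename_vars seen vs)" if w: "w \<in> set (args \<phi>)" for w
    proof -
      have "w \<in> set (rename_vars (seen @ vs) (occurrences as))"
        using w \<open>\<phi> \<in> _\<close> unfolding occurrences_rename_body[symmetric]
        by (auto simp: occurrences_def)
      then show ?thesis
        using rename_vars_Occ rename_vars_bounds by (metis not_le)
    qed
    then show ?thesis by (cases \<phi>) (auto simp: \<theta>_def)
  qed
  then have "inst \<theta> ` set (rename_body (seen @ vs) as) \<subseteq> F" using \<theta>2(1) by auto
  moreover have "map \<theta> (rename_vars seen vs) = ts" using \<theta>1(1) by (auto simp: \<theta>_def)
  moreover have "Q (\<sigma> v) (\<theta> (Occ v i))"
    if "count_list seen v < i" "i \<le> count_list (seen @ vs @ occurrences as) v" for v i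
    using \<theta>1(2)[of v i] \<theta>2(2)[of v i] that by (auto simp: \<theta>_def rename_vars_bounds)
  ultimately show ?case using ts(1) by (intro exI[of _ \<theta>]) (auto simp: id_def)
qed auto

section \<open>The union of all singularizations and its existential rules\<close>

definition sing_rules :: "('a, 'r) tbox \<Rightarrow> ('a, 'r) dl_rule set" where
  "sing_rules T = \<Union> (Sing (Sigma_of T))"

text \<open>One concrete singularization, fixed for the simulation and for the Skolem symbols of
  \<open>lift_trm\<close>: the first occurrence represents each variable.\<close>

definition sing_first :: "('a, 'r) dl_rule \<Rightarrow> ('a, 'r) dl_rule" where
  "sing_first \<rho> = (case \<rho> of TGD b h \<Rightarrow> singularize (\<lambda>_. 1) b h | EGD b x y \<Rightarrow> EGD b x y)"

text \<open>Index 1 is admissible because a body variable occurs at least once.\<close>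

lemma sing_family: "Eq_axioms \<union> sing_first ` Sigma_of T \<in> Sing (Sigma_of T)"
proof -
  have "sing_first \<rho> \<in> singularizations \<rho>" if "\<rho> \<in> Sigma_of T" for \<rho>
  proof -
    from that obtain b h where "\<rho> = TGD b h"
      unfolding Sigma_of_def by (metis eq_to_tgd.elims imageE)
    then show ?thesis
      unfolding sing_first_def singularizations_def
      by (auto simp: avars_def intro!: exI[of _ "\<lambda>_. Suc 0"] dest: count_list_pos)
  qed
  then show ?thesis unfolding Sing_def by blast
qed

lemma Eq_axioms_sub: "Eq_axioms \<subseteq> sing_rules T"
  using sing_family[of T] by (auto simp: sing_rules_def)

lemma sing_first_in:
  assumes "TGD b h \<in> Sigma_of T"
  shows "singularize (\<lambda>_. 1) b h \<in> sing_rules T"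
proof -
  have "sing_first (TGD b h) \<in> sing_rules T"
    unfolding sing_rules_def using sing_family assms by blast
  then show ?thesis by (simp add: sing_first_def)
qed

lemma TGD_in_Sigma: "TGD b h \<in> rules_of T \<Longrightarrow> TGD b h \<in> Sigma_of T"
  unfolding Sigma_of_def by (metis eq_to_tgd.simps(1) image_eqI)

lemma EGD_in_Sigma: "EGD b x y \<in> rules_of T \<Longrightarrow> TGD b [Atom Eq [x, y]] \<in> Sigma_of T"
  unfolding Sigma_of_def by (metis eq_to_tgd.simps(2) image_eqI)

lemma top_rule_all: "\<exists>b h. top_rule p = TGD b h \<and> avars h \<subseteq> avars b"
  by (cases p) (simp_all add: top_rule_def avars_def Let_def numeral_2_eq_2)

text \<open>An empty conjunction must be excluded: it would give a rule with empty body, whose head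
  variable would count as existential.\<close>

lemma rule_of_cases:
  assumes "\<And>B. \<alpha> \<noteq> ConjSub [] B"
  shows "(\<exists>A R B. \<alpha> = SubEx A R B) \<or>
    (\<exists>b h. eq_to_tgd (rule_of \<alpha>) = TGD b h \<and> avars h \<subseteq> avars b)"
proof (cases \<alpha>)
  case (ConjSub As B)
  with assms obtain A As' where "As = A # As'" by (cases As) auto
  with ConjSub show ?thesis by (auto simp: avars_def)
qed (auto simp: avars_def)

text \<open>Ensures that the TGD replacing an EGD has no existential variable.\<close>

lemma EGD_vars: "EGD b x y \<in> rules_of T \<Longrightarrow> {x, y} \<subseteq> avars b"
proof -
  assume "EGD b x y \<in> rules_of T"
  moreover have "top_rule p \<noteq> EGD b x y" for p using top_rule_all[of p] by auto
  ultimately obtain \<alpha> where "rule_of \<alpha> = EGD b x y"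
    unfolding rules_of_def by (metis UnE imageE)
  then show ?thesis by (cases \<alpha>) (auto simp: avars_def ex_rule_def)
qed

text \<open>Since \<open>X\<close> occurs once in the body, this is the only singularization of
  \<open>ex_rule A R B\<close>. Hence an existential axiom contributes a single Skolem symbol to the
  union.\<close>

definition sing_ex_rule :: "'a concept \<Rightarrow> 'r \<Rightarrow> 'a concept \<Rightarrow> ('a, 'r) dl_rule" where
  "sing_ex_rule A R B =
     TGD [Atom (Conc A) [Occ X 1]] [Atom (Role R) [Occ X 1, Y], Atom (Conc B) [Y]]"

lemma singularize_ex_rule:
  assumes "j X = 1"
  shows "singularize j [Atom (Conc A) [X]] [Atom (Role R) [X, Y], Atom (Conc B) [Y]] =
    sing_ex_rule A R B"
  using assms by (simp add: singularize_def sing_ex_rule_def eq_atoms_def avars_def)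

lemma ex_rule_in_rules_of: "ex_rule A R B \<in> rules_of T \<Longrightarrow> SubEx A R B \<in> T"
proof -
  assume "ex_rule A R B \<in> rules_of T"
  moreover have "top_rule p \<noteq> ex_rule A R B" for p
    by (cases p) (auto simp: top_rule_def ex_rule_def Let_def)
  ultimately obtain \<alpha> where "\<alpha> \<in> T" "rule_of \<alpha> = ex_rule A R B"
    unfolding rules_of_def by (metis UnE imageE)
  then show ?thesis by (cases \<alpha>) (auto simp: ex_rule_def)
qed

text \<open>This locates every source of Skolem terms. Rules without existential variables stay so
  because their head variables become occurrences of body variables.\<close>

lemma sing_rules_cases:
  assumes "horn_sriq_tbox T" "TGD b h \<in> sing_rules T"
  shows "avars h \<subseteq> avars b \<or> (\<exists>A R B. SubEx A R B \<in> T \<and> TGD b h = sing_ex_rule A R B)"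
proof -
  consider "TGD b h \<in> Eq_axioms"
    | \<rho> where "\<rho> \<in> Sigma_of T" "TGD b h \<in> singularizations \<rho>"
    using assms(2) by (auto simp: sing_rules_def Sing_def)
  then show ?thesis
  proof cases
    case 1
    then show ?thesis by (auto simp: Eq_axioms_def avars_def)
  next
    case 2
    then obtain j b0 h0 where \<rho>: "\<rho> = TGD b0 h0" "TGD b h = singularize j b0 h0"
      and j: "\<forall>v \<in> avars b0. 1 \<le> j v \<and> j v \<le> count_list (occurrences b0) v"
      by (auto simp: singularizations_def)
    have all: "avars h \<subseteq> avars b" if "avars h0 \<subseteq> avars b0"
    proof
      fix w assume "w \<in> avars h"
      then obtain v where "v \<in> avars h0" "w = (if v \<in> avars b0 then Occ v (j v) else v)"
        using \<rho>(2) by (auto simp: singularize_def avars_inst)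
      then show "w \<in> avars b"
        using that avars_singularize_head[OF j, of v] \<rho>(2) by (auto simp: singularize_def)
    qed
    from 2(1) consider p where "\<rho> = eq_to_tgd (top_rule p)"
      | \<alpha> where "\<alpha> \<in> T" "\<rho> = eq_to_tgd (rule_of \<alpha>)"
      by (auto simp: Sigma_of_def rules_of_def)
    then show ?thesis
    proof cases
      case 1
      then show ?thesis using top_rule_all[of p] \<rho>(1) all by auto
    next
      case 2
      show ?thesis
      proof (cases "\<exists>A R B. \<alpha> = SubEx A R B")
        case True
        then obtain A R B where \<alpha>: "\<alpha> = SubEx A R B" by blast
        then have "b0 = [Atom (Conc A) [X]]" "h0 = [Atom (Role R) [X, Y], Atom (Conc B) [Y]]"
          using 2 \<rho>(1) by (auto simp: ex_rule_def)
        moreover from this have "j X = 1" using j by (auto simp: avars_def)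
        ultimately have "TGD b h = sing_ex_rule A R B"
          using \<rho>(2) singularize_ex_rule[of j A R B] by simp
        then show ?thesis using 2(1) \<alpha> by blast
      next
        case False
        moreover have "\<alpha> \<noteq> ConjSub [] B" for B
          using assms(1) 2(1) by (auto simp: horn_sriq_tbox_def)
        ultimately show ?thesis using rule_of_cases[of \<alpha>] 2(2) \<rho>(1) all by auto
      qed
    qed
  qed
qed

section \<open>The oblivious chase\<close>

text \<open>Matched terms come from earlier facts, and a head variable outside the body can only be
  the \<open>Y\<close> of a singularized existential rule, which puts its own symbol on top.\<close>

lemma ochase_symbols:
  fixes t :: "('a, 'r, 'i) dl_trm"
  assumes T: "horn_sriq_tbox T" and "\<phi> \<in> ochase (sing_rules T)" "t \<in> set (args \<phi>)"
  shows "set1_trm t \<subseteq> {(sing_ex_rule A R B, Y) | A R B. SubEx A R B \<in> T}"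
  using assms(2,3)
proof (induction arbitrary: t rule: ochase.induct)
  case (ochase_crit \<phi>)
  then show ?case by (auto simp: critical_instance_def)
next
  case (ochase_step b h \<sigma> \<psi>)
  have body: "set1_trm (\<sigma> v) \<subseteq> {(sing_ex_rule A R B, Y) | A R B. SubEx A R B \<in> T}"
    if "v \<in> avars b" for v
  proof -
    from that obtain \<phi> where "\<phi> \<in> set b" "v \<in> set (args \<phi>)"
      by (auto simp: avars_def occurrences_def)
    then show ?thesis using ochase_step.IH by (auto simp: atom.map_sel)
  qed
  from ochase_step.prems obtain v where v: "v \<in> set (args \<psi>)" "t = sk_subst b h \<sigma> v"
    by (auto simp: atom.map_sel)
  with ochase_step have vh: "v \<in> avars h" by (auto simp: avars_def occurrences_def)
  show ?case
  proof (cases "v \<in> avars b")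
    case True
    then show ?thesis using v body by (simp add: sk_subst_def)
  next
    case False
    with sing_rules_cases[OF T ochase_step(1)] vh obtain A R B where
      r: "SubEx A R B \<in> T" "TGD b h = sing_ex_rule A R B" by blast
    then have "v = Y" using vh False by (auto simp: sing_ex_rule_def avars_def)
    then show ?thesis
      using v False r body by (fastforce simp: sk_subst_def frontier_vars_def avars_def)
  qed
qed

lemma ochase_dep_le:
  fixes T :: "('a, 'r) tbox"
  assumes "horn_sriq_tbox T" "MFA_union TYPE('i) T"
    and "t \<in> terms_in (ochase (sing_rules T) :: ('a, 'r, 'i) dl_fact set)"
  shows "dep t \<le> card (existential_axioms T)"
proof -
  let ?S = "{(sing_ex_rule A R B, Y) | A R B. SubEx A R B \<in> T}"
  \<comment> \<open>One Skolem symbol per existential axiom: the symbols lie in the image of the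
    axioms under \<open>?f\<close>, so there are at most as many.\<close>
  let ?f = "\<lambda>\<alpha>. case \<alpha> of SubEx A R B \<Rightarrow> (sing_ex_rule A R B, Y)"
  have "finite T" using assms(1) by (simp add: horn_sriq_tbox_def)
  then have fin: "finite (existential_axioms T)"
    by (rule rev_finite_subset) (auto simp: existential_axioms_def)
  have S: "?S \<subseteq> ?f ` existential_axioms T"
    by (force simp: existential_axioms_def)
  have "\<not> cyclic t"
    using assms(2,3) by (auto simp: MFA_union_def MFA_def sing_rules_def)
  then have "dep t \<le> card (set1_trm t)" by (rule acyclic_dep_le)
  also have "set1_trm t \<subseteq> ?S"
    using ochase_symbols[OF assms(1)] assms(3) unfolding terms_in_def by blast
  then have "card (set1_trm t) \<le> card (?f ` existential_axioms T)"
    using S fin by (intro card_mono) auto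
  also have "\<dots> \<le> card (existential_axioms T)" using fin by (rule card_image_le)
  finally show ?thesis .
qed

section \<open>Equality and fresh Skolem terms in the oblivious chase\<close>

lemma ochase_Eq:
  shows ochase_Eq_refl: "Atom (Conc Top) [t] \<in> ochase (sing_rules T) \<Longrightarrow>
      Atom Eq [t, t] \<in> ochase (sing_rules T)"
    and ochase_Eq_sym: "Atom Eq [t, u] \<in> ochase (sing_rules T) \<Longrightarrow>
      Atom Eq [u, t] \<in> ochase (sing_rules T)"
    and ochase_Eq_trans: "Atom Eq [t, u] \<in> ochase (sing_rules T) \<Longrightarrow>
      Atom Eq [u, v] \<in> ochase (sing_rules T) \<Longrightarrow> Atom Eq [t, v] \<in> ochase (sing_rules T)"
proof -
  note ax = subsetD[OF Eq_axioms_sub[of T]]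
  show "Atom Eq [t, t] \<in> ochase (sing_rules T)"
    if "Atom (Conc Top) [t] \<in> ochase (sing_rules T)"
    using ochase_step[of "[Atom (Conc Top) [X]]" "[Atom Eq [X, X]]" "sing_rules T" "\<lambda>_. t"] that
    by (simp add: ax Eq_axioms_def sk_subst_def avars_def)
  show "Atom Eq [u, t] \<in> ochase (sing_rules T)"
    if "Atom Eq [t, u] \<in> ochase (sing_rules T)"
    using ochase_step[of "[Atom Eq [X, Y]]" "[Atom Eq [Y, X]]" "sing_rules T"
        "\<lambda>v. if v = X then t else u"] that
    by (simp add: ax Eq_axioms_def sk_subst_def avars_def)
  show "Atom Eq [t, v] \<in> ochase (sing_rules T)"
    if "Atom Eq [t, u] \<in> ochase (sing_rules T)" "Atom Eq [u, v] \<in> ochase (sing_rules T)"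
    using ochase_step[of "[Atom Eq [X, Z], Atom Eq [Z, Y]]" "[Atom Eq [X, Y]]" "sing_rules T"
        "\<lambda>w. if w = X then t else if w = Z then u else v"] that
    by (simp add: ax Eq_axioms_def sk_subst_def avars_def)
qed

lemma ochase_ex:
  assumes "ex_rule A R B \<in> rules_of T" "Atom (Conc A) [t] \<in> ochase (sing_rules T)"
  defines "u \<equiv> Fun (sing_ex_rule A R B, Y) [t]"
  shows "Atom (Role R) [t, u] \<in> ochase (sing_rules T)"
    and "Atom (Conc B) [u] \<in> ochase (sing_rules T)"
    and "Atom Eq [u, u] \<in> ochase (sing_rules T)"
proof -
  let ?b = "[Atom (Conc A) [Occ X 1]]" and ?h = "[Atom (Role R) [Occ X 1, Y], Atom (Conc B) [Y]]"
  have "TGD ?b ?h \<in> sing_rules T"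
    using sing_first_in[OF TGD_in_Sigma[OF assms(1)[unfolded ex_rule_def]]]
      singularize_ex_rule[of "\<lambda>_. 1" A R B] by (simp add: sing_ex_rule_def)
  note step = ochase_step[OF this, of "\<lambda>_. t"]
  show "Atom (Role R) [t, u] \<in> ochase (sing_rules T)"
    using step[of "Atom (Role R) [Occ X 1, Y]"] assms(2)
    by (simp add: sk_subst_def frontier_vars_def avars_def u_def sing_ex_rule_def)
  show B: "Atom (Conc B) [u] \<in> ochase (sing_rules T)"
    using step[of "Atom (Conc B) [Y]"] assms(2)
    by (simp add: sk_subst_def frontier_vars_def avars_def u_def sing_ex_rule_def)
  \<comment> \<open>The rule deriving \<open>Top\<close> from \<open>B\<close> has one body
    occurrence, so its singularization carries no \<open>Eq\<close> atom and fires on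
    \<open>u\<close>; reflexivity then follows from \<open>Top\<close>.\<close>
  have "SubEx A R B \<in> T" using assms(1) by (rule ex_rule_in_rules_of)
  then have "top_rule (Conc B) \<in> rules_of T" by (force simp: rules_of_def ex_rule_def)
  then have "TGD [Atom (Conc B) [X]] [Atom (Conc Top) [X]] \<in> Sigma_of T"
    by (intro TGD_in_Sigma) (simp add: top_rule_def Let_def)
  then have "TGD [Atom (Conc B) [Occ X 1]] [Atom (Conc Top) [Occ X 1]] \<in> sing_rules T"
    using sing_first_in by (fastforce simp: singularize_def eq_atoms_def avars_def)
  from ochase_step[OF this, of "\<lambda>_. u"] B show "Atom Eq [u, u] \<in> ochase (sing_rules T)"
    by (intro ochase_Eq_refl) (simp add: sk_subst_def avars_def)
qed

section \<open>Simulation of \<open>V\<close> in the oblivious chase\<close>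

text \<open>\<open>f(s)\<close> is sent to \<open>f(s')\<close>, where \<open>s'\<close> is a deepest term that is \<open>Eq\<close>-equivalent to the image
  of \<open>s\<close> and satisfies the body of the rule of \<open>f\<close>. Since \<open>Eq\<close> need not be a congruence, one \<open>s'\<close>
  has to be fixed; choosing a deepest one preserves the depth bound.\<close>

fun lift_trm :: "('a, 'r, 'i) dl_fact set \<Rightarrow> ('a, 'r, 'i) dl_trm \<Rightarrow> ('a, 'r, 'i) dl_trm" where
  "lift_trm F (Fun (TGD b h, y) [s]) = Fun (sing_first (TGD b h), y)
     [arg_max dep (\<lambda>t. Atom Eq [t, lift_trm F s] \<in> F \<and> Atom (pred_of (hd b)) [t] \<in> F)]"
| "lift_trm F t = t"

text \<open>Equivalence is tested against one fixed image, so in the chase any two shadows of the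
  same term are \<open>Eq\<close>-equivalent.\<close>

definition shadow ::
    "('a, 'r, 'i) dl_fact set \<Rightarrow> ('a, 'r, 'i) dl_trm \<Rightarrow> ('a, 'r, 'i) dl_trm \<Rightarrow> bool" where
  "shadow F t t' \<longleftrightarrow> Atom Eq [t', lift_trm F t] \<in> F \<and> dep t \<le> dep t'"

definition shadowed :: "('a, 'r, 'i) dl_fact set \<Rightarrow> ('a, 'r, 'i) dl_fact set" where
  "shadowed F = {Atom p ts | p ts. \<exists>ts'. Atom p ts' \<in> F \<and> list_all2 (shadow F) ts ts'}"

text \<open>The occurrences of a variable may have different shadows, which singularized bodies
  tolerate: all are equivalent to the image of \<open>\<sigma> v\<close>, so the added
  \<open>Eq\<close> atoms hold. The head is shadowed by the terms of the first occurrences.\<close>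

lemma shadowed_rule:
  fixes T :: "('a, 'r) tbox" and \<sigma> :: "var \<Rightarrow> ('a, 'r, 'i) dl_trm"
  defines "F \<equiv> ochase (sing_rules T)"
  assumes rule: "TGD b h \<in> Sigma_of T" "avars h \<subseteq> avars b"
    and body: "inst \<sigma> ` set b \<subseteq> shadowed F" and \<psi>: "\<psi> \<in> set h"
  shows "inst \<sigma> \<psi> \<in> shadowed F"
proof -
  have "\<exists>ts. Atom p ts \<in> F \<and> list_all2 (shadow F) (map \<sigma> vs) ts" if "Atom p vs \<in> set b" for p vs
    using body that by (force simp: shadowed_def)
  from match_rename_body[of b F "shadow F" \<sigma> "[]", OF this] obtain \<theta> where
    \<theta>: "inst \<theta> ` set (rename_body [] b) \<subseteq> F"
    "\<And>v i. 0 < i \<Longrightarrow> i \<le> count_list (occurrences b) v \<Longrightarrow> shadow F (\<sigma> v) (\<theta> (Occ v i))"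
    by auto
  have one: "\<forall>v \<in> avars b. 1 \<le> (1::nat) \<and> 1 \<le> count_list (occurrences b) v"
    using count_list_pos by (auto simp: avars_def)
  let ?b = "rename_body [] b @ eq_atoms (\<lambda>_. 1) (occurrences b)"
  let ?r = "\<lambda>v. if v \<in> avars b then Occ v 1 else v"
  have "inst \<theta> \<phi> \<in> F" if "\<phi> \<in> set (eq_atoms (\<lambda>_. 1) (occurrences b))" for \<phi>
  proof -
    from that obtain v i where \<phi>: "\<phi> = Atom Eq [Occ v i, Occ v 1]"
      "1 \<le> i" "i \<le> count_list (occurrences b) v"
      by (auto simp: eq_atoms_def)
    then have "shadow F (\<sigma> v) (\<theta> (Occ v i))" "shadow F (\<sigma> v) (\<theta> (Occ v 1))"
      using \<theta>(2) by auto
    then have "Atom Eq [\<theta> (Occ v i), \<theta> (Occ v 1)] \<in> F"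
      unfolding shadow_def F_def using ochase_Eq_sym ochase_Eq_trans by blast
    then show ?thesis by (simp add: \<phi>)
  qed
  with \<theta>(1) have "\<forall>\<phi> \<in> set ?b. inst \<theta> \<phi> \<in> F" by auto
  with ochase_step[OF sing_first_in[OF rule(1), unfolded singularize_def], of \<theta> "inst ?r \<psi>"] \<psi>
  have "inst (sk_subst ?b (map (inst ?r) h) \<theta>) (inst ?r \<psi>) \<in> F"
    by (simp add: F_def)
  moreover have "sk_subst ?b (map (inst ?r) h) \<theta> (?r v) = \<theta> (Occ v 1)" "shadow F (\<sigma> v) (\<theta> (Occ v 1))"
    if "v \<in> set (args \<psi>)" for v
  proof -
    have v: "v \<in> avars b" using that \<psi> rule(2) by (auto simp: avars_def occurrences_def)
    then show "sk_subst ?b (map (inst ?r) h) \<theta> (?r v) = \<theta> (Occ v 1)"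
      using avars_singularize_head[OF one v] by (simp add: sk_subst_def)
    show "shadow F (\<sigma> v) (\<theta> (Occ v 1))" using \<theta>(2)[of 1 v] one v by auto
  qed
  ultimately show ?thesis
    by (cases \<psi>) (auto simp: shadowed_def list_all2_map1 list_all2_map2 list_all2_same
        cong: map_cong intro!: exI[of _ "map (\<lambda>v. \<theta> (Occ v 1)) (args \<psi>)"])
qed

text \<open>\<open>Eq\<close> links the image of \<open>t\<close> to its shadow \<open>t'\<close>,
  then to \<open>u'\<close>, then to the image of \<open>u\<close>; symmetry and transitivity do the
  rest.\<close>

lemma shadowed_Eq:
  fixes T :: "('a, 'r) tbox" and t u :: "('a, 'r, 'i) dl_trm"
  defines "F \<equiv> ochase (sing_rules T)"
  assumes "Atom Eq [t, u] \<in> shadowed F"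
  shows "Atom Eq [lift_trm F u, lift_trm F t] \<in> F" "Atom Eq [u, t] \<in> shadowed F"
proof -
  from assms(2) obtain t' u' where *: "Atom Eq [t', u'] \<in> F" "shadow F t t'" "shadow F u u'"
    by (auto simp: shadowed_def list_all2_Cons1)
  then show "Atom Eq [lift_trm F u, lift_trm F t] \<in> F"
    unfolding shadow_def F_def by (meson ochase_Eq_sym ochase_Eq_trans)
  have "Atom Eq [u', t'] \<in> F" using * unfolding F_def by (meson ochase_Eq_sym)
  then show "Atom Eq [u, t] \<in> shadowed F"
    using * by (force simp: shadowed_def)
qed

lemma shadowed_replace:
  fixes T :: "('a, 'r) tbox" and t u :: "('a, 'r, 'i) dl_trm"
  defines "F \<equiv> ochase (sing_rules T)"
  assumes "Atom Eq [t, u] \<in> shadowed F" "dep t \<le> dep u" "Atom p us \<in> shadowed F"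
  shows "Atom p (map (\<lambda>w. if w = u then t else w) us) \<in> shadowed F"
proof -
  from assms(4) obtain us' where us': "Atom p us' \<in> F" "list_all2 (shadow F) us us'"
    by (auto simp: shadowed_def)
  \<comment> \<open>A shadow of \<open>u\<close> also serves for \<open>t\<close>: the images are
    equivalent, and \<open>dep t \<le> dep u\<close> keeps it deep enough. So the fact in
    \<open>F\<close> stays the same.\<close>
  have "shadow F t u'" if "shadow F u u'" for u'
    using shadowed_Eq(1)[OF assms(2)[unfolded F_def]] that assms(3) ochase_Eq_trans
    unfolding shadow_def F_def by fastforce
  then have "list_all2 (shadow F) (map (\<lambda>w. if w = u then t else w) us) us'"
    using us'(2) by (auto simp: list_all2_map1 elim!: list_all2_mono)
  then show ?thesis using us'(1) by (auto simp: shadowed_def)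
qed

text \<open>The rule fires in \<open>F\<close> on \<open>?s\<close> rather than on the given shadow
  \<open>t'\<close>, because \<open>lift_trm\<close> builds on \<open>?s\<close>; maximality gives
  \<open>dep t \<le> dep t' \<le> dep ?s\<close>.\<close>

lemma shadowed_ex:
  fixes T :: "('a, 'r) tbox" and t :: "('a, 'r, 'i) dl_trm"
  defines "F \<equiv> ochase (sing_rules T)"
  assumes bound: "\<And>t. t \<in> terms_in F \<Longrightarrow> dep t \<le> m"
    and rule: "ex_rule A R B \<in> rules_of T" and body: "Atom (Conc A) [t] \<in> shadowed F"
  shows "{Atom (Role R) [t, sk_ex A R B t], Atom (Conc B) [sk_ex A R B t]} \<subseteq> shadowed F"
proof -
  let ?P = "\<lambda>s. Atom Eq [s, lift_trm F t] \<in> F \<and> Atom (Conc A) [s] \<in> F"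
  let ?s = "arg_max dep ?P"
  let ?u = "Fun (sing_ex_rule A R B, Y) [?s]"
  from body obtain t' where t': "Atom (Conc A) [t'] \<in> F" "shadow F t t'"
    by (auto simp: shadowed_def list_all2_Cons1)
  then have P: "?P t'" by (simp add: shadow_def)
  \<comment> \<open>A deepest candidate exists because the depths are bounded; \<open>Suc m\<close>
    turns the bound into a strict one, as \<open>arg_max_nat_lemma\<close> requires.\<close>
  have "dep s < Suc m" if "?P s" for s
    using bound[of s] that by (force simp: terms_in_def less_Suc_eq_le)
  with arg_max_nat_lemma[of ?P t' dep "Suc m"] P
  have s: "?P ?s" "dep t' \<le> dep ?s" by auto
  \<comment> \<open>The rule body starts with \<open>Conc A\<close>, so \<open>?s\<close> is exactly
    the argument chosen by \<open>lift_trm\<close>.\<close>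
  have lift: "lift_trm F (sk_ex A R B t) = ?u"
    using singularize_ex_rule[of "\<lambda>_. 1" A R B] by (simp add: ex_rule_def sing_first_def)
  have ts: "shadow F t ?s" using s t'(2) by (auto simp: shadow_def)
  note ex = ochase_ex[OF rule, of ?s, folded F_def]
  have "shadow F (sk_ex A R B t) ?u"
    using ex s(1) ts unfolding shadow_def lift by auto
  moreover have "Atom (Role R) [?s, ?u] \<in> F" "Atom (Conc B) [?u] \<in> F"
    using ex s(1) by auto
  ultimately show ?thesis using ts by (fastforce simp: shadowed_def)
qed

text \<open>Singularization keeps all predicates, so the same critical facts occur in the chase;
  each is its own shadow once \<open>Star\<close> is \<open>Eq\<close>-related to itself.\<close>

lemma critical_shadowed:
  fixes T :: "('a, 'r) tbox"
  shows
  "critical_instance (rules_of T) \<subseteq> shadowed (ochase (sing_rules T))"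
proof
  fix \<phi> :: "('a, 'r, 'i) dl_fact"
  let ?F = "ochase (sing_rules T) :: ('a, 'r, 'i) dl_fact set"
  assume "\<phi> \<in> critical_instance (rules_of T)"
  then obtain p b h where \<phi>: "\<phi> = Atom p (replicate (arity p) (Const Star))"
    and r: "TGD b h \<in> rules_of T" "p \<in> rule_preds (TGD b h)"
    by (auto simp: critical_instance_def)
  have "p \<in> rule_preds (singularize (\<lambda>_. 1) b h)"
    using r(2) pred_of_rename_body[of "[]" b]
    by (auto simp: singularize_def atom.map_sel image_Un image_image)
  then have "\<phi> \<in> ?F"
    using sing_first_in[OF TGD_in_Sigma[OF r(1)]] unfolding \<phi>
    by (intro ochase_crit) (force simp: critical_instance_def singularize_def)
  \<comment> \<open>\<open>Eq\<close> occurs in the equality axioms, so this fact is itself a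
    critical one.\<close>
  moreover have "Atom Eq [Const Star, Const Star] \<in> ?F"
  proof (rule ochase_crit)
    have "TGD [Atom Eq [X, Y]] [Atom Eq [Y, X]] \<in> sing_rules T"
      using Eq_axioms_sub[of T] by (auto simp: Eq_axioms_def)
    then show "Atom Eq [Const Star, Const Star] \<in> critical_instance (sing_rules T)"
      unfolding critical_instance_def
      by (intro CollectI exI[of _ Eq]) (force simp: numeral_2_eq_2)
  qed
  then have "shadow ?F (Const Star) (Const Star)" by (simp add: shadow_def)
  ultimately show "\<phi> \<in> shadowed ?F"
    by (auto simp: shadowed_def \<phi> list_all2_same intro!: exI[of _ "replicate (arity p) (Const Star)"])
qed

text \<open>The depth bound serves the existential case, where a deepest candidate must
  exist.\<close>

lemma V_closed_shadowed:
  fixes T :: "('a, 'r) tbox" and prec :: "('a, 'r, 'i) dl_trm \<Rightarrow> ('a, 'r, 'i) dl_trm \<Rightarrow> bool"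
  defines "F \<equiv> ochase (sing_rules T)"
  assumes bound: "\<And>t. t \<in> terms_in F \<Longrightarrow> dep t \<le> m"
  shows "V_closed prec T (shadowed F)"
  unfolding V_closed_def
proof (intro conjI allI impI ballI; (elim conjE)?)
  fix \<rho> assume "\<rho> \<in> all_rules (rules_of T)"
  then obtain b h where \<rho>: "\<rho> = TGD b h" "TGD b h \<in> rules_of T" and vars: "avars h \<subseteq> avars b"
    by (auto simp: all_rules_def)
  show "tgd_apply \<rho> (shadowed F) \<subseteq> shadowed F"
  proof
    fix \<phi> assume "\<phi> \<in> tgd_apply \<rho> (shadowed F)"
    then obtain \<sigma> \<psi> where *: "inst \<sigma> ` set b \<subseteq> shadowed F" "\<psi> \<in> set h"
      "\<phi> = inst (sk_subst b h \<sigma>) \<psi>"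
      using \<rho>(1) by (auto simp: tgd_apply_def)
    \<comment> \<open>All head variables occur in the body, so Skolemization leaves the instance
      unchanged.\<close>
    have "sk_subst b h \<sigma> v = \<sigma> v" if "v \<in> set (args \<psi>)" for v
      using that vars *(2) by (auto simp: sk_subst_def avars_def occurrences_def)
    then have "\<phi> = inst \<sigma> \<psi>" using *(3) by (cases \<psi>) auto
    then show "\<phi> \<in> shadowed F"
      using shadowed_rule[OF TGD_in_Sigma[OF \<rho>(2)] vars, of \<sigma>] * by (simp add: F_def)
  qed
next
  fix A R B t
  assume "ex_rule A R B \<in> rules_of T" "Atom (Conc A) [t] \<in> shadowed F"
  then show "{Atom (Role R) [t, sk_ex A R B t], Atom (Conc B) [sk_ex A R B t]} \<subseteq> shadowed F"
    using shadowed_ex[OF bound[unfolded F_def]] by (simp add: F_def)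
next
  fix b x y \<sigma>
  assume egd: "EGD b x y \<in> rules_of T" and body: "inst \<sigma> ` set b \<subseteq> shadowed F"
  have "avars [Atom Eq [x, y]] \<subseteq> avars b" using EGD_vars[OF egd] by (simp add: avars_def)
  then have "Atom Eq [\<sigma> x, \<sigma> y] \<in> shadowed F"
    using shadowed_rule[OF EGD_in_Sigma[OF egd], of \<sigma> "Atom Eq [x, y]"] body by (simp add: F_def)
  then show "{Atom Eq [\<sigma> x, \<sigma> y], Atom Eq [\<sigma> y, \<sigma> x]} \<subseteq> shadowed F"
    using shadowed_Eq(2)[of "\<sigma> x" "\<sigma> y" T] by (simp add: F_def)
next
  fix t u p us
  assume "Atom Eq [t, u] \<in> shadowed F" "Atom p us \<in> shadowed F" "dep t \<le> dep u"
  then show "Atom p (map (\<lambda>w. if w = u then t else w) us) \<in> shadowed F"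
    using shadowed_replace[of t u T p us] by (simp add: F_def)
qed

theorem theorem5:
  fixes T :: "('a, 'r) tbox"
    and prec :: "('a, 'r, 'i) dl_trm \<Rightarrow> ('a, 'r, 'i) dl_trm \<Rightarrow> bool"
  assumes "horn_sriq_tbox T"
    and "term_order prec"
    and "MFA_union TYPE('i) T"
  shows "\<forall>n > card (existential_axioms T). RCA prec n T"
proof (intro allI impI)
  fix n assume n: "card (existential_axioms T) < n"
  let ?F = "ochase (sing_rules T) :: ('a, 'r, 'i) dl_fact set"
  have bound: "dep t \<le> card (existential_axioms T)" if "t \<in> terms_in ?F" for t
    using ochase_dep_le assms(1,3) that by blast
  \<comment> \<open>\<open>V_set\<close> is the intersection of the closed sets containing the
    critical instance, and the shadowed facts form one of these.\<close>
  have V: "V_set prec T \<subseteq> shadowed ?F"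
    using V_closed_shadowed[of T, OF bound] critical_shadowed[of T]
    by (auto simp: V_set_def)
  \<comment> \<open>An argument is no deeper than its shadow, which obeys the bound in the
    chase.\<close>
  have "dep t \<le> card (existential_axioms T)" if "t \<in> terms_in (V_set prec T)" for t
  proof -
    from that V obtain p ts ts' where "t \<in> set ts" "Atom p ts' \<in> ?F" "list_all2 (shadow ?F) ts ts'"
      by (fastforce simp: terms_in_def shadowed_def)
    then obtain t' where "t' \<in> set ts'" "dep t \<le> dep t'"
      by (metis in_set_conv_nth list_all2_conv_all_nth shadow_def)
    then show ?thesis using bound[of t'] \<open>Atom p ts' \<in> ?F\<close> by (force simp: terms_in_def)
  qed
  then show "RCA prec n T"
    using n n_cyclic_imp_dep unfolding RCA_def by (meson le_less_trans less_asym)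
qed

end
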